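(* Let $\mathbb{M}_n$ be a manifold with local coordinates $z^i$ and nondegenerate Poisson bracket $\{\cdot,\cdot\}$, let $H$ be a function on $\mathbb{M}_n$, and let $\Phi^\alpha(z)$, $\alpha=1,\dots,n-k$, be functionally independent functions such that $\triangle^{\alpha\beta}=\{\Phi^\alpha,\Phi^\beta\}$ satisfies $$\det\triangle^{\alpha\beta}\big|_{\Phi^\alpha=0}\neq0,\qquad \{\Phi^\alpha,H\}\big|_{\Phi^\alpha=0}=0 .$$ Let $z^i=(z^\alpha,z^a)$ and let $z^\alpha=f^\alpha(z^a)$ be the parametric equations of $\mathbb{N}_k=\{\Phi^\alpha=0\}$, with local coordinates $x^a=z^a$. Let $\{A,B\}_{D(\mathbb{N})}=\partial_aA\,\omega_{\mathbf f}^{ab}\,\partial_bB$, where, with $\tilde\triangle_{\alpha\beta}$ the inverse matrix of $\triangle^{\alpha\beta}$, $$\omega_{\mathbf f}^{ab}(x)=\left.\left(\{z^a,z^b\}-\{z^a,\Phi^\alpha\}\tilde\triangle_{\alpha\beta}\{\Phi^\beta,z^b\}\right)\right|_{z^\alpha=f^\alpha(x),\,z^a=x^a}.$$ Then the system $\dot z^i=\{z^i,H\}$, $\Phi^\alpha(z)=0$ on $\mathbb{M}_n$ is equivalent to the Hamiltonian system on $\mathbb{N}_k$ $$\dot x^a=\{x^a,\hat H\}_{D(\mathbb{N})},\qquad \hat H(x)=H(f^\alpha(x),x),$$ that is, a curve $z^i(\tau)=(z^\alpha(\tau),z^a(\tau))$ is a solution of the former if and only if $z^\alpha(\tau)=f^\alpha(z^b(\tau))$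 and $x^a(\tau)=z^a(\tau)$ is a solution of the latter.
   Context: All objects are smooth, and all statements are local. Repeated indices are summed and the dot is $d/d\tau$. A Poisson bracket is $\{A,B\}=\partial_iA\,\omega^{ij}\,\partial_jB$ with $\omega^{ij}=-\omega^{ji}$ and $\omega^{ip}\partial_p\omega^{jk}+\mathrm{cycle}(i,j,k)=0$; it is nondegenerate if $\det\omega\neq0$. Functions $\Phi^\alpha$ are functionally independent if $\operatorname{rank}(\partial_i\Phi^\alpha)=n-k$; coordinates are then grouped as $z^i=(z^\alpha,z^a)$, $a=1,\dots,k$, with $\det(\partial\Phi^\alpha/\partial z^\beta)\ne0$, so that $\Phi^\alpha=0$ can be solved as $z^\alpha=f^\alpha(z^a)$. *)

theory Defs
  imports "HOL-Analysis.Analysis"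
begin

definition partial_deriv :: "'n::finite \<Rightarrow> (real^'n \<Rightarrow> real) \<Rightarrow> real^'n \<Rightarrow> real" where
  "partial_deriv i F z = frechet_derivative F (at z) (axis i 1)"

text \<open>The following notions of smoothness are meant for open domains only.\<close>

fun C_diff_on :: "nat \<Rightarrow> (real^'n::finite) set \<Rightarrow> (real^'n \<Rightarrow> real) \<Rightarrow> bool" where
  "C_diff_on 0 U F \<longleftrightarrow> continuous_on U F"
| "C_diff_on (Suc r) U F \<longleftrightarrow>
     (\<forall>z\<in>U. F differentiable (at z)) \<and> (\<forall>i. C_diff_on r U (partial_deriv i F))"

definition smooth_on :: "(real^'n::finite) set \<Rightarrow> (real^'n \<Rightarrow> real) \<Rightarrow> bool" where
  "smooth_on U F \<longleftrightarrow> (\<forall>r. C_diff_on r U F)"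

definition bracket ::
    "(real^'n::finite \<Rightarrow> real^'n^'n) \<Rightarrow> (real^'n \<Rightarrow> real) \<Rightarrow> (real^'n \<Rightarrow> real) \<Rightarrow> real^'n \<Rightarrow> real" where
  "bracket \<omega> A B z =
     (\<Sum>i\<in>UNIV. \<Sum>j\<in>UNIV. partial_deriv i A z * \<omega> z $ i $ j * partial_deriv j B z)"

definition poisson_on :: "(real^'n::finite) set \<Rightarrow> (real^'n \<Rightarrow> real^'n^'n) \<Rightarrow> bool" where
  "poisson_on U \<omega> \<longleftrightarrow>
     (\<forall>i j. smooth_on U (\<lambda>z. \<omega> z $ i $ j)) \<and>
     (\<forall>z\<in>U. \<forall>i j. \<omega> z $ i $ j = - \<omega> z $ j $ i) \<and>
     (\<forall>z\<in>U. \<forall>i j k.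
        (\<Sum>p\<in>UNIV. \<omega> z $ i $ p * partial_deriv p (\<lambda>w. \<omega> w $ j $ k) z)
      + (\<Sum>p\<in>UNIV. \<omega> z $ j $ p * partial_deriv p (\<lambda>w. \<omega> w $ k $ i) z)
      + (\<Sum>p\<in>UNIV. \<omega> z $ k $ p * partial_deriv p (\<lambda>w. \<omega> w $ i $ j) z) = 0)"

definition nondegenerate_on :: "(real^'n::finite) set \<Rightarrow> (real^'n \<Rightarrow> real^'n^'n) \<Rightarrow> bool" where
  "nondegenerate_on U \<omega> \<longleftrightarrow> (\<forall>z\<in>U. det (\<omega> z) \<noteq> 0)"

definition functionally_independent_on ::
    "(real^'n::finite) set \<Rightarrow> ('m::finite \<Rightarrow> real^'n \<Rightarrow> real) \<Rightarrow> bool" where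
  "functionally_independent_on U \<Phi> \<longleftrightarrow>
     (\<forall>z\<in>U. rank ((\<chi> \<alpha> i. partial_deriv i (\<Phi> \<alpha>) z) :: real^'n^'m) = CARD('m))"

definition constraint_surface ::
    "(real^'n::finite) set \<Rightarrow> ('m::finite \<Rightarrow> real^'n \<Rightarrow> real) \<Rightarrow> (real^'n) set" where
  "constraint_surface U \<Phi> = {z\<in>U. \<forall>\<alpha>. \<Phi> \<alpha> z = 0}"

definition constraint_matrix ::
    "(real^'n::finite \<Rightarrow> real^'n^'n) \<Rightarrow> ('m::finite \<Rightarrow> real^'n \<Rightarrow> real) \<Rightarrow> real^'n \<Rightarrow> real^'m^'m" where
  "constraint_matrix \<omega> \<Phi> z = (\<chi> \<alpha> \<beta>. bracket \<omega> (\<Phi> \<alpha>) (\<Phi> \<beta>) z)"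

text \<open>
  The grouping of coordinates into two blocks is encoded by the index type \<open>'m + 'k\<close>:
  \<open>Inl \<alpha>\<close> is the index of a coordinate solved for, \<open>Inr a\<close> that of a coordinate retained
  on the surface. Hence \<open>CARD('m + 'k)\<close> is n and \<open>CARD('m)\<close> is n - k.
\<close>

definition join_coords :: "real^'m \<Rightarrow> real^'k \<Rightarrow> real^('m::finite + 'k::finite)" where
  "join_coords y x = (\<chi> i. case i of Inl \<alpha> \<Rightarrow> y $ \<alpha> | Inr a \<Rightarrow> x $ a)"

definition retained_coords :: "real^('m::finite + 'k::finite) \<Rightarrow> real^'k" where
  "retained_coords z = (\<chi> a. z $ Inr a)"

definition surface_tensor ::
    "(real^('m::finite + 'k::finite) \<Rightarrow> real^('m + 'k)^('m + 'k)) \<Rightarrow>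
     ('m \<Rightarrow> real^('m + 'k) \<Rightarrow> real) \<Rightarrow> (real^'k \<Rightarrow> real^'m) \<Rightarrow> real^'k \<Rightarrow> real^'k^'k" where
  "surface_tensor \<omega> \<Phi> f x =
     (let z = join_coords (f x) x in
      \<chi> a b. bracket \<omega> (\<lambda>w. w $ Inr a) (\<lambda>w. w $ Inr b) z
        - (\<Sum>\<alpha>\<in>UNIV. \<Sum>\<beta>\<in>UNIV.
             bracket \<omega> (\<lambda>w. w $ Inr a) (\<Phi> \<alpha>) z
             * matrix_inv (constraint_matrix \<omega> \<Phi> z) $ \<alpha> $ \<beta>
             * bracket \<omega> (\<Phi> \<beta>) (\<lambda>w. w $ Inr b) z))"

definition hamiltonian_solution ::
    "(real^'n::finite) set \<Rightarrow> (real^'n \<Rightarrow> real^'n^'n) \<Rightarrow> (real^'n \<Rightarrow> real) \<Rightarrow>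
     real set \<Rightarrow> (real \<Rightarrow> real^'n) \<Rightarrow> bool" where
  "hamiltonian_solution U \<omega> H T z \<longleftrightarrow>
     (\<forall>\<tau>\<in>T. z \<tau> \<in> U \<and>
       (\<forall>i. ((\<lambda>t. z t $ i) has_real_derivative bracket \<omega> (\<lambda>w. w $ i) H (z \<tau>)) (at \<tau>)))"

end

(* On the surface the Dirac tensor D^{ij} = {z^i,z^j} - {z^i,Phi^a} inv(Delta)_{ab} {Phi^b,z^j}
   satisfies D^{ij} d_j H = {z^i,H} and annihilates every d Phi^c. A vector annihilated by all d Phi^c
   is tangent to the surface z^alpha = f^alpha(z^a), hence determined by its retained components.
   Applied to the rows of D this gives D^{aj} d_j H = D^{ab} d_b (H o f); applied to the Hamiltonian
   vector field it recovers the equations for the eliminated coordinates z^alpha. *)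

theory Submission imports Defs begin

section \<open>Partial derivatives and brackets in coordinates\<close>

lemma sum_UNIV_Plus:
  "(\<Sum>i\<in>(UNIV :: ('m::finite + 'k::finite) set). g i) = (\<Sum>\<alpha>\<in>UNIV. g (Inl \<alpha>)) + (\<Sum>a\<in>UNIV. g (Inr a))"
  for g :: "_ \<Rightarrow> 'b::comm_monoid_add"
  by (simp add: UNIV_Plus_UNIV[symmetric] sum.Plus del: UNIV_Plus_UNIV)

lemma smooth_on_imp_differentiable:
  assumes "smooth_on U F" "z \<in> U"
  shows "F differentiable (at z)"
  using assms C_diff_on.simps(2)[of 0 U F] unfolding smooth_on_def by blast

lemma has_derivative_partial_deriv:
  fixes F :: "real^'n::finite \<Rightarrow> real"
  assumes "F differentiable (at z)"
  shows "(F has_derivative (\<lambda>v. \<Sum>i\<in>UNIV. partial_deriv i F z * v $ i)) (at z)"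
proof -
  let ?D = "frechet_derivative F (at z)"
  have D: "(F has_derivative ?D) (at z)"
    using assms by (simp add: frechet_derivative_works)
  have "linear ?D"
    using D has_derivative_linear by blast
  then have "?D v = (\<Sum>i\<in>UNIV. ?D (axis i 1) * v $ i)" for v
    using linear_sum[of ?D "\<lambda>i. v $ i *s axis i 1" UNIV] basis_expansion[of v]
    by (simp add: linear_cmul scalar_mult_eq_scaleR mult.commute)
  then have "?D = (\<lambda>v. \<Sum>i\<in>UNIV. partial_deriv i F z * v $ i)"
    unfolding partial_deriv_def by (rule ext)
  with D show ?thesis by simp
qed

lemma partial_deriv_eqI:
  assumes "(F has_derivative F') (at z)"
  shows "partial_deriv i F z = F' (axis i 1)"
  using frechet_derivative_at[OF assms] by (simp add: partial_deriv_def)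

lemma partial_deriv_coord: "partial_deriv i (\<lambda>w. w $ j) z = (if i = j then 1 else 0)"
proof -
  have "((\<lambda>w. w $ j) has_derivative (\<lambda>v. v $ j)) (at z)"
    by (rule bounded_linear_imp_has_derivative[OF bounded_linear_vec_nth])
  from partial_deriv_eqI[OF this] show ?thesis by (auto simp: axis_def)
qed

lemma bracket_coord_left:
  "bracket \<omega> (\<lambda>w. w $ i) B z = (\<Sum>j\<in>UNIV. \<omega> z $ i $ j * partial_deriv j B z)"
proof -
  have "bracket \<omega> (\<lambda>w. w $ i) B z =
      (\<Sum>l\<in>UNIV. if l = i then (\<Sum>j\<in>UNIV. \<omega> z $ l $ j * partial_deriv j B z) else 0)"
    unfolding bracket_def by (rule sum.cong) (auto simp: partial_deriv_coord)
  then show ?thesis by simp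
qed

lemma bracket_coord_coord: "bracket \<omega> (\<lambda>w. w $ i) (\<lambda>w. w $ j) z = \<omega> z $ i $ j"
  by (simp add: bracket_coord_left partial_deriv_coord if_distrib cong: if_cong)

text \<open>Serves to contract the Dirac tensor with dB: it collapses {\<Phi>^\<beta>, z^j} d_j B to
  {\<Phi>^\<beta>, B}.\<close>

lemma bracket_expand_right:
  "bracket \<omega> A B z = (\<Sum>j\<in>UNIV. bracket \<omega> A (\<lambda>w. w $ j) z * partial_deriv j B z)"
proof -
  have "bracket \<omega> A (\<lambda>w. w $ j) z = (\<Sum>i\<in>UNIV. partial_deriv i A z * \<omega> z $ i $ j)" for j
    unfolding bracket_def by (simp add: partial_deriv_coord if_distrib cong: if_cong)
  then show ?thesis
    unfolding bracket_def by (subst sum.swap) (simp add: sum_distrib_right)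
qed

text \<open>Reads {A, B} as the differential of A applied to the Hamiltonian vector field of B. With
  A = \<Phi>^\<alpha> and B = H, a vanishing bracket says that the vector field of H annihilates d
  \<Phi>^\<alpha>.\<close>

lemma bracket_expand_left:
  "bracket \<omega> A B z = (\<Sum>i\<in>UNIV. partial_deriv i A z * bracket \<omega> (\<lambda>w. w $ i) B z)"
  by (simp add: bracket_coord_left) (simp add: bracket_def sum_distrib_left mult.assoc)

section \<open>Differentiation along the graph and its tangent vectors\<close>

lemma has_derivative_graph:
  fixes f :: "real^'k::finite \<Rightarrow> real^'m::finite"
  assumes "\<And>\<alpha>. (\<lambda>x. f x $ \<alpha>) differentiable (at x)"
  shows "((\<lambda>x. join_coords (f x) x) has_derivative
    (\<lambda>v. join_coords (\<chi> \<alpha>. \<Sum>b\<in>UNIV. partial_deriv b (\<lambda>x. f x $ \<alpha>) x * v $ b) v)) (at x)"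
    (is "(?g has_derivative ?g') _")
proof -
  have comp: "((\<lambda>y. ?g y $ i) has_derivative (\<lambda>v. ?g' v $ i)) (at x)" for i
    using has_derivative_partial_deriv[OF assms]
    by (cases i)
      (auto simp: join_coords_def intro: bounded_linear_imp_has_derivative)
  show ?thesis
    using comp by (subst has_derivative_componentwise_within)
      (auto simp: Basis_vec_def inner_axis)
qed

text \<open>Chain rule along the graph, used in two ways. For a constraint the left side vanishes,
  which is implicit differentiation of \<Phi>^\<alpha>(f(x), x) = 0; for H it gives the gradient of
  the reduced Hamiltonian.\<close>

lemma partial_deriv_graph:
  fixes f :: "real^'k::finite \<Rightarrow> real^'m::finite"
  assumes f: "\<And>\<alpha>. (\<lambda>x. f x $ \<alpha>) differentiable (at x)"
    and F: "F differentiable (at (join_coords (f x) x))"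
  shows "partial_deriv b (\<lambda>x. F (join_coords (f x) x)) x =
    partial_deriv (Inr b) F (join_coords (f x) x) +
    (\<Sum>\<beta>\<in>UNIV. partial_deriv (Inl \<beta>) F (join_coords (f x) x) * partial_deriv b (\<lambda>x. f x $ \<beta>) x)"
proof -
  let ?g = "\<lambda>x. join_coords (f x) x"
  let ?g' = "\<lambda>v. join_coords (\<chi> \<alpha>. \<Sum>c\<in>UNIV. partial_deriv c (\<lambda>x. f x $ \<alpha>) x * v $ c) v"
  let ?F' = "\<lambda>v. \<Sum>i\<in>UNIV. partial_deriv i F (?g x) * v $ i"
  have g: "(?g has_derivative ?g') (at x)"
    using f by (rule has_derivative_graph)
  have F': "(F has_derivative ?F') (at (?g x))"
    using F by (rule has_derivative_partial_deriv)
  have "((\<lambda>x. F (?g x)) has_derivative (\<lambda>v. ?F' (?g' v))) (at x)"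
    using g F' by (rule has_derivative_compose)
  then have *: "partial_deriv b (\<lambda>x. F (?g x)) x = ?F' (?g' (axis b 1))"
    by (rule partial_deriv_eqI)
  have "(\<Sum>c\<in>UNIV. p c * axis b 1 $ c) = p b" for p :: "'k \<Rightarrow> real"
    by (simp add: axis_def if_distrib cong: if_cong)
  then have "?F' (?g' (axis b 1)) = partial_deriv (Inr b) F (?g x) +
      (\<Sum>\<beta>\<in>UNIV. partial_deriv (Inl \<beta>) F (?g x) * partial_deriv b (\<lambda>x. f x $ \<beta>) x)"
    unfolding sum_UNIV_Plus by (simp add: join_coords_def)
  with * show ?thesis by (rule trans)
qed

text \<open>Pure linear algebra: \<open>J\<close> stands for the Jacobian of the constraints and
  \<open>df\<close> for that of \<open>f\<close>. The graph vector with the same retained components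
  as \<open>v\<close> is also annihilated by \<open>J\<close>, so it differs from \<open>v\<close>
  only in the eliminated block, where \<open>J\<close> is invertible.\<close>

lemma annihilated_imp_tangent:
  fixes J :: "'m::finite \<Rightarrow> 'm + 'k::finite \<Rightarrow> real"
  assumes det: "det (\<chi> \<alpha> \<beta>. J \<alpha> (Inl \<beta>)) \<noteq> 0"
    and df: "\<And>\<alpha> b. J \<alpha> (Inr b) + (\<Sum>\<beta>\<in>UNIV. J \<alpha> (Inl \<beta>) * df \<beta> b) = 0"
    and v: "\<And>\<alpha>. (\<Sum>i\<in>UNIV. J \<alpha> i * v i) = 0"
  shows "v (Inl \<beta>) = (\<Sum>b\<in>UNIV. df \<beta> b * v (Inr b))"
proof -
  let ?A = "(\<chi> \<alpha> \<beta>. J \<alpha> (Inl \<beta>)) :: real^'m^'m"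
  \<comment> \<open>The eliminated-block deviation of \<open>v\<close> from the graph vector with
    the same retained components; it will lie in the kernel of \<open>?A\<close>.\<close>
  let ?u = "(\<chi> \<beta>. v (Inl \<beta>) - (\<Sum>b\<in>UNIV. df \<beta> b * v (Inr b))) :: real^'m"
  have "(\<Sum>\<beta>\<in>UNIV. J \<alpha> (Inl \<beta>) * (\<Sum>b\<in>UNIV. df \<beta> b * v (Inr b))) =
      - (\<Sum>b\<in>UNIV. J \<alpha> (Inr b) * v (Inr b))" for \<alpha>
  proof -
    have "(\<Sum>\<beta>\<in>UNIV. J \<alpha> (Inl \<beta>) * (\<Sum>b\<in>UNIV. df \<beta> b * v (Inr b))) =
      (\<Sum>b\<in>UNIV. (\<Sum>\<beta>\<in>UNIV. J \<alpha> (Inl \<beta>) * df \<beta> b) * v (Inr b))"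
      unfolding sum_distrib_left sum_distrib_right mult.assoc by (rule sum.swap)
    also have "\<dots> = (\<Sum>b\<in>UNIV. - J \<alpha> (Inr b) * v (Inr b))"
      using df by (intro sum.cong) (simp_all add: eq_neg_iff_add_eq_0 add.commute flip: distrib_right)
    finally show ?thesis by (simp add: sum_negf)
  qed
  then have "?A *v ?u = 0"
    using v by (auto simp: vec_eq_iff matrix_vector_mult_def sum_UNIV_Plus right_diff_distrib sum_subtractf)
  then have "?u = 0"
    using det matrix_left_invertible_ker[of ?A]
    unfolding invertible_det_nz[symmetric] invertible_left_inverse by blast
  then show ?thesis by (simp add: vec_eq_iff)
qed

section \<open>The Dirac tensor in the ambient coordinates\<close>

text \<open>The formula of \<open>surface_tensor\<close> with indices ranging over all coordinates:
  the eliminated entries of a row are needed to apply the tangency argument to it. The inverse is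
  meaningful only where the constraint matrix is invertible.\<close>

definition dirac_tensor ::
    "(real^'n::finite \<Rightarrow> real^'n^'n) \<Rightarrow> ('m::finite \<Rightarrow> real^'n \<Rightarrow> real) \<Rightarrow> real^'n \<Rightarrow> real^'n^'n" where
  "dirac_tensor \<omega> \<Phi> z = (\<chi> i j. \<omega> z $ i $ j
     - (\<Sum>\<alpha>\<in>UNIV. \<Sum>\<beta>\<in>UNIV. bracket \<omega> (\<lambda>w. w $ i) (\<Phi> \<alpha>) z
         * matrix_inv (constraint_matrix \<omega> \<Phi> z) $ \<alpha> $ \<beta> * bracket \<omega> (\<Phi> \<beta>) (\<lambda>w. w $ j) z))"

lemma surface_tensor_eq_dirac_tensor:
  "surface_tensor \<omega> \<Phi> f x $ a $ b = dirac_tensor \<omega> \<Phi> (join_coords (f x) x) $ Inr a $ Inr b"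
  by (simp add: surface_tensor_def dirac_tensor_def Let_def bracket_coord_coord)

text \<open>The right side is the Dirac bracket of z^i with B. It reduces to {z^i, B} wherever all
  {\<Phi>^\<beta>, B} vanish.\<close>

lemma dirac_tensor_contract:
  "(\<Sum>j\<in>UNIV. dirac_tensor \<omega> \<Phi> z $ i $ j * partial_deriv j B z) = bracket \<omega> (\<lambda>w. w $ i) B z
     - (\<Sum>\<alpha>\<in>UNIV. \<Sum>\<beta>\<in>UNIV. bracket \<omega> (\<lambda>w. w $ i) (\<Phi> \<alpha>) z
         * matrix_inv (constraint_matrix \<omega> \<Phi> z) $ \<alpha> $ \<beta> * bracket \<omega> (\<Phi> \<beta>) B z)"
proof -
  let ?c = "\<lambda>\<alpha> \<beta>. bracket \<omega> (\<lambda>w. w $ i) (\<Phi> \<alpha>) z * matrix_inv (constraint_matrix \<omega> \<Phi> z) $ \<alpha> $ \<beta>"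
  have "(\<Sum>j\<in>UNIV. (\<Sum>\<alpha>\<in>UNIV. \<Sum>\<beta>\<in>UNIV. ?c \<alpha> \<beta> * bracket \<omega> (\<Phi> \<beta>) (\<lambda>w. w $ j) z) * partial_deriv j B z)
      = (\<Sum>\<alpha>\<in>UNIV. \<Sum>\<beta>\<in>UNIV. \<Sum>j\<in>UNIV. ?c \<alpha> \<beta> * (bracket \<omega> (\<Phi> \<beta>) (\<lambda>w. w $ j) z * partial_deriv j B z))"
    unfolding sum_distrib_right mult.assoc
    \<comment> \<open>The sum over j moves past \<alpha> and then past \<beta>, so that it acts on
      the last bracket alone.\<close>
    by (subst sum.swap, rule sum.cong[OF refl], rule sum.swap)
  also have "\<dots> = (\<Sum>\<alpha>\<in>UNIV. \<Sum>\<beta>\<in>UNIV. ?c \<alpha> \<beta> * bracket \<omega> (\<Phi> \<beta>) B z)"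
    unfolding sum_distrib_left[symmetric] bracket_expand_right[of \<omega> _ B, symmetric] ..
  finally show ?thesis
    by (simp add: dirac_tensor_def bracket_coord_left[of \<omega> i B] left_diff_distrib sum_subtractf)
qed

text \<open>The constraints are Casimir functions of the Dirac bracket: for B = \<Phi>^\<gamma> the
  last factor of the correction is a column of the constraint matrix, its product with the inverse
  is the Kronecker delta, and what remains cancels {z^i, \<Phi>^\<gamma>}.\<close>

lemma dirac_tensor_contract_constraint:
  assumes "det (constraint_matrix \<omega> \<Phi> z) \<noteq> 0"
  shows "(\<Sum>j\<in>UNIV. dirac_tensor \<omega> \<Phi> z $ i $ j * partial_deriv j (\<Phi> \<gamma>) z) = 0"
proof -
  let ?C = "constraint_matrix \<omega> \<Phi> z"
  \<comment> \<open>\<open>matrix_inv\<close> is a choice among two-sided inverses; the nonzero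
    determinant supplies one, and the second conjunct is the left-inverse property.\<close>
  have "matrix_inv ?C ** ?C = mat 1"
    using assms unfolding matrix_inv_def invertible_det_nz[symmetric] invertible_def
    by (rule someI_ex[THEN conjunct2])
  then have inv: "(\<Sum>\<beta>\<in>UNIV. matrix_inv ?C $ \<alpha> $ \<beta> * bracket \<omega> (\<Phi> \<beta>) (\<Phi> \<gamma>) z) = (if \<alpha> = \<gamma> then 1 else 0)" for \<alpha>
    by (auto simp: vec_eq_iff matrix_matrix_mult_def mat_def constraint_matrix_def)
  show ?thesis
    unfolding dirac_tensor_contract mult.assoc sum_distrib_left[symmetric] inv
    by (simp add: if_distrib cong: if_cong)
qed

section \<open>Reduction of the Hamiltonian vector field at a point of the surface\<close>

lemma bracket_surface_tensor:
  fixes \<Phi> :: "'m::finite \<Rightarrow> real^('m + 'k::finite) \<Rightarrow> real"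
  assumes w: "w = join_coords (f x) x"
    and f: "\<And>\<alpha>. (\<lambda>x. f x $ \<alpha>) differentiable (at x)"
    and H: "H differentiable (at w)"
    and C: "det (constraint_matrix \<omega> \<Phi> w) \<noteq> 0"
    and \<Phi>H: "\<And>\<alpha>. bracket \<omega> (\<Phi> \<alpha>) H w = 0"
    and det: "det (\<chi> \<alpha> \<beta>. partial_deriv (Inl \<beta>) (\<Phi> \<alpha>) w) \<noteq> 0"
    and df: "\<And>\<alpha> b. partial_deriv (Inr b) (\<Phi> \<alpha>) w +
      (\<Sum>\<beta>\<in>UNIV. partial_deriv (Inl \<beta>) (\<Phi> \<alpha>) w * partial_deriv b (\<lambda>x. f x $ \<beta>) x) = 0"
  shows "bracket (surface_tensor \<omega> \<Phi> f) (\<lambda>y. y $ a) (\<lambda>x. H (join_coords (f x) x)) x =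
    bracket \<omega> (\<lambda>w. w $ Inr a) H w"
proof -
  let ?D = "dirac_tensor \<omega> \<Phi> w $ Inr a"
  let ?f = "\<lambda>\<beta> b. partial_deriv b (\<lambda>x. f x $ \<beta>) x"
  have "(\<Sum>j\<in>UNIV. partial_deriv j (\<Phi> \<gamma>) w * ?D $ j) = 0" for \<gamma>
    using dirac_tensor_contract_constraint[OF C, of "Inr a" \<gamma>] by (simp add: mult.commute)
  \<comment> \<open>The Casimir property makes row \<open>Inr a\<close> of the Dirac tensor a
    tangent vector, which fixes its eliminated entries.\<close>
  from annihilated_imp_tangent[where J = "\<lambda>\<alpha> i. partial_deriv i (\<Phi> \<alpha>) w" and v = "\<lambda>j. ?D $ j", OF det df this]
  have D: "?D $ Inl \<beta> = (\<Sum>b\<in>UNIV. ?f \<beta> b * ?D $ Inr b)" for \<beta> .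
  \<comment> \<open>The Dirac correction drops out because each of its terms carries a factor
    {\<Phi>^\<beta>, H}, which is zero at \<open>w\<close>.\<close>
  have "bracket \<omega> (\<lambda>w. w $ Inr a) H w = (\<Sum>j\<in>UNIV. ?D $ j * partial_deriv j H w)"
    by (simp add: dirac_tensor_contract \<Phi>H)
  also have "\<dots> = (\<Sum>b\<in>UNIV. ?D $ Inr b * partial_deriv (Inr b) H w) +
      (\<Sum>\<beta>\<in>UNIV. \<Sum>b\<in>UNIV. ?D $ Inr b * (partial_deriv (Inl \<beta>) H w * ?f \<beta> b))"
    by (simp add: sum_UNIV_Plus D sum_distrib_left sum_distrib_right mult_ac)
  also have "\<dots> = (\<Sum>b\<in>UNIV. ?D $ Inr b * (partial_deriv (Inr b) H w +
      (\<Sum>\<beta>\<in>UNIV. partial_deriv (Inl \<beta>) H w * ?f \<beta> b)))"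
    unfolding distrib_left sum.distrib sum_distrib_left
    by (rule arg_cong2[where f = "(+)", OF refl sum.swap])
  \<comment> \<open>The parenthesis is the chain rule for H along the graph, and the retained block
    of the Dirac tensor is \<open>surface_tensor\<close>.\<close>
  also have "\<dots> = (\<Sum>b\<in>UNIV. surface_tensor \<omega> \<Phi> f x $ a $ b *
      partial_deriv b (\<lambda>x. H (join_coords (f x) x)) x)"
    unfolding surface_tensor_eq_dirac_tensor partial_deriv_graph[OF f H[unfolded w]] w ..
  finally show ?thesis
    unfolding bracket_coord_left[of "surface_tensor \<omega> \<Phi> f"] by (rule sym)
qed

section \<open>Equivalence of the two systems\<close>

lemma retained_coords_join_coords [simp]: "retained_coords (join_coords y x) = x"
  by (simp add: retained_coords_def join_coords_def vec_eq_iff)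

text \<open>With \<open>y\<close> the value of \<open>f\<close> at the retained coordinates, this
  turns the equations z^\<alpha> = f^\<alpha> into membership in the graph.\<close>

lemma eq_join_coords_iff:
  "z = join_coords y (retained_coords z) \<longleftrightarrow> (\<forall>\<alpha>. z $ Inl \<alpha> = y $ \<alpha>)"
  by (auto simp: vec_eq_iff join_coords_def retained_coords_def split: sum.split)

theorem mainTheorem9:
  fixes U :: "(real^('m::finite + 'k::finite)) set"
    and \<omega> :: "real^('m + 'k) \<Rightarrow> real^('m + 'k)^('m + 'k)"
    and H :: "real^('m + 'k) \<Rightarrow> real"
    and \<Phi> :: "'m \<Rightarrow> real^('m + 'k) \<Rightarrow> real"
    and V :: "(real^'k) set"
    and f :: "real^'k \<Rightarrow> real^'m"
    and T :: "real set"
    and z :: "real \<Rightarrow> real^('m + 'k)"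
  assumes "open U"
    and "poisson_on U \<omega>"
    and "nondegenerate_on U \<omega>"
    and "smooth_on U H"
    and "\<And>\<alpha>. smooth_on U (\<Phi> \<alpha>)"
    and "functionally_independent_on U \<Phi>"
    and "\<And>w. w \<in> constraint_surface U \<Phi> \<Longrightarrow> det (constraint_matrix \<omega> \<Phi> w) \<noteq> 0"
    and "\<And>w \<alpha>. w \<in> constraint_surface U \<Phi> \<Longrightarrow> bracket \<omega> (\<Phi> \<alpha>) H w = 0"
    and "\<And>w. w \<in> U \<Longrightarrow> det (\<chi> \<alpha> \<beta>. partial_deriv (Inl \<beta>) (\<Phi> \<alpha>) w) \<noteq> 0"
    and "open V"
    and "\<And>\<alpha>. smooth_on V (\<lambda>x. f x $ \<alpha>)"
    and "constraint_surface U \<Phi> = (\<lambda>x. join_coords (f x) x) ` V"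
    and "open T" and "is_interval T"
  shows
    "hamiltonian_solution U \<omega> H T z \<and> (\<forall>\<tau>\<in>T. \<forall>\<alpha>. \<Phi> \<alpha> (z \<tau>) = 0)
     \<longleftrightarrow>
     (\<forall>\<tau>\<in>T. \<forall>\<alpha>. z \<tau> $ Inl \<alpha> = f (retained_coords (z \<tau>)) $ \<alpha>) \<and>
     hamiltonian_solution V (surface_tensor \<omega> \<Phi> f) (\<lambda>x. H (join_coords (f x) x)) T
       (\<lambda>\<tau>. retained_coords (z \<tau>))"
proof -
  let ?g = "\<lambda>x. join_coords (f x) x"
  let ?W = "\<lambda>i. bracket \<omega> (\<lambda>w. w $ i) H"
  let ?f = "\<lambda>\<beta> b. partial_deriv b (\<lambda>x. f x $ \<beta>)"
  note surface = \<open>constraint_surface U \<Phi> = ?g ` V\<close>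
  have gS: "?g x \<in> constraint_surface U \<Phi>" if "x \<in> V" for x
    using that surface by blast
  have gU: "?g x \<in> U" and g0: "\<Phi> \<alpha> (?g x) = 0" if "x \<in> V" for x \<alpha>
    using gS[OF that] by (auto simp: constraint_surface_def)
  have f: "(\<lambda>x. f x $ \<alpha>) differentiable (at x)" if "x \<in> V" for x \<alpha>
    using smooth_on_imp_differentiable assms(11) that by blast
  \<comment> \<open>Implicit differentiation: \<Phi>^\<alpha> composed with the graph map is
    identically zero on the open set \<open>V\<close>, so its partial derivatives vanish
    there.\<close>
  have df: "partial_deriv (Inr b) (\<Phi> \<alpha>) (?g x) +
      (\<Sum>\<beta>\<in>UNIV. partial_deriv (Inl \<beta>) (\<Phi> \<alpha>) (?g x) * ?f \<beta> b x) = 0" if x: "x \<in> V" for x \<alpha> b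
  proof -
    have "((\<lambda>x. \<Phi> \<alpha> (?g x)) has_derivative (\<lambda>v. 0)) (at x)"
      by (rule has_derivative_transform_within_open[OF has_derivative_const[of 0] \<open>open V\<close> x])
        (simp add: g0)
    then have "partial_deriv b (\<lambda>x. \<Phi> \<alpha> (?g x)) x = 0"
      by (rule partial_deriv_eqI)
    then show ?thesis
      using partial_deriv_graph[OF f[OF x], of "\<Phi> \<alpha>"]
        smooth_on_imp_differentiable[OF assms(5) gU[OF x]] by simp
  qed
  have red: "bracket (surface_tensor \<omega> \<Phi> f) (\<lambda>y. y $ a) (\<lambda>x. H (?g x)) x = ?W (Inr a) (?g x)"
    if x: "x \<in> V" for x a
    by (rule bracket_surface_tensor[OF refl f[OF x] smooth_on_imp_differentiable[OF assms(4) gU[OF x]]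
          assms(7)[OF gS[OF x]] assms(8)[OF gS[OF x]] assms(9)[OF gU[OF x]] df[OF x]])
  \<comment> \<open>The condition {\<Phi>^\<alpha>, H} = 0 makes the Hamiltonian vector field
    tangent to the surface.\<close>
  have tangent: "?W (Inl \<beta>) (?g x) = (\<Sum>b\<in>UNIV. ?f \<beta> b x * ?W (Inr b) (?g x))"
    if x: "x \<in> V" for x \<beta>
  proof (rule annihilated_imp_tangent[where v = "\<lambda>i. ?W i (?g x)", OF assms(9)[OF gU[OF x]] df[OF x]])
    show "(\<Sum>i\<in>UNIV. partial_deriv i (\<Phi> \<alpha>) (?g x) * ?W i (?g x)) = 0" for \<alpha>
      using assms(8)[OF gS[OF x]] by (simp flip: bracket_expand_left)
  qed
  show ?thesis
  proof
    assume L: "hamiltonian_solution U \<omega> H T z \<and> (\<forall>\<tau>\<in>T. \<forall>\<alpha>. \<Phi> \<alpha> (z \<tau>) = 0)"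
    have zg: "retained_coords (z \<tau>) \<in> V \<and> z \<tau> = ?g (retained_coords (z \<tau>))" if "\<tau> \<in> T" for \<tau>
    proof -
      \<comment> \<open>A constrained solution stays on the surface, which is the image of the graph
        map; the parameter in \<open>V\<close> is then recovered as the retained
        coordinates.\<close>
      have "z \<tau> \<in> ?g ` V"
        unfolding surface[symmetric]
        using L that by (auto simp: hamiltonian_solution_def constraint_surface_def)
      then show ?thesis by auto
    qed
    show "(\<forall>\<tau>\<in>T. \<forall>\<alpha>. z \<tau> $ Inl \<alpha> = f (retained_coords (z \<tau>)) $ \<alpha>) \<and>
      hamiltonian_solution V (surface_tensor \<omega> \<Phi> f) (\<lambda>x. H (?g x)) T (\<lambda>\<tau>. retained_coords (z \<tau>))"
      unfolding hamiltonian_solution_def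
    proof (intro conjI ballI allI)
      fix \<tau> assume \<tau>: "\<tau> \<in> T"
      show "z \<tau> $ Inl \<alpha> = f (retained_coords (z \<tau>)) $ \<alpha>" for \<alpha>
        using zg[OF \<tau>] eq_join_coords_iff by blast
      show "retained_coords (z \<tau>) \<in> V" using zg[OF \<tau>] by blast
      have "bracket (surface_tensor \<omega> \<Phi> f) (\<lambda>w. w $ a) (\<lambda>x. H (?g x)) (retained_coords (z \<tau>)) =
          ?W (Inr a) (z \<tau>)" for a
        using red[OF zg[OF \<tau>, THEN conjunct1], of a]
        unfolding zg[OF \<tau>, THEN conjunct2, symmetric] .
      then show "((\<lambda>t. retained_coords (z t) $ a) has_real_derivative
          bracket (surface_tensor \<omega> \<Phi> f) (\<lambda>w. w $ a) (\<lambda>x. H (?g x)) (retained_coords (z \<tau>))) (at \<tau>)" for a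
        using L \<tau> by (simp add: hamiltonian_solution_def) (simp add: retained_coords_def)
    qed
  next
    assume R: "(\<forall>\<tau>\<in>T. \<forall>\<alpha>. z \<tau> $ Inl \<alpha> = f (retained_coords (z \<tau>)) $ \<alpha>) \<and>
      hamiltonian_solution V (surface_tensor \<omega> \<Phi> f) (\<lambda>x. H (?g x)) T (\<lambda>\<tau>. retained_coords (z \<tau>))"
    have xV: "retained_coords (z \<tau>) \<in> V" if "\<tau> \<in> T" for \<tau>
      using R that by (simp add: hamiltonian_solution_def)
    have zg: "z \<tau> = ?g (retained_coords (z \<tau>))" if "\<tau> \<in> T" for \<tau>
      using R that eq_join_coords_iff by blast
    have dr: "((\<lambda>t. z t $ Inr a) has_real_derivative ?W (Inr a) (z \<tau>)) (at \<tau>)" if \<tau>: "\<tau> \<in> T" for \<tau> a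
    proof -
      have "((\<lambda>t. retained_coords (z t) $ a) has_real_derivative
          bracket (surface_tensor \<omega> \<Phi> f) (\<lambda>w. w $ a) (\<lambda>x. H (?g x)) (retained_coords (z \<tau>))) (at \<tau>)"
        using R \<tau> by (simp add: hamiltonian_solution_def)
      then show ?thesis
        unfolding red[OF xV[OF \<tau>]] zg[OF \<tau>, symmetric] by (simp add: retained_coords_def)
    qed
    \<comment> \<open>The reduced system has no equation for z^\<alpha>. Differentiating f^\<alpha>
      along the reduced curve gives the derivative, and \<open>tangent\<close> identifies it with
      {z^\<alpha>, H}.\<close>
    have dl: "((\<lambda>t. z t $ Inl \<alpha>) has_real_derivative ?W (Inl \<alpha>) (z \<tau>)) (at \<tau>)" if \<tau>: "\<tau> \<in> T" for \<tau> \<alpha>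
    proof -
      let ?x = "\<lambda>t. retained_coords (z t)"
      let ?v = "(\<chi> a. ?W (Inr a) (z \<tau>)) :: real^'k"
      have "((\<lambda>t. ?x t $ a) has_derivative (\<lambda>h. (h *\<^sub>R ?v) $ a)) (at \<tau>)" for a
        using dr[OF \<tau>, of a] by (simp add: retained_coords_def has_field_derivative_def mult_commute_abs)
      then have x': "(?x has_derivative (\<lambda>h. h *\<^sub>R ?v)) (at \<tau>)"
        by (subst has_derivative_componentwise_within) (auto simp: Basis_vec_def inner_axis)
      have "((\<lambda>t. f (?x t) $ \<alpha>) has_derivative
          (\<lambda>h. \<Sum>b\<in>UNIV. ?f \<alpha> b (?x \<tau>) * (h *\<^sub>R ?v) $ b)) (at \<tau>)"
        by (rule has_derivative_compose[OF x' has_derivative_partial_deriv[OF f[OF xV[OF \<tau>]]]])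
      also have "(\<lambda>h. \<Sum>b\<in>UNIV. ?f \<alpha> b (?x \<tau>) * (h *\<^sub>R ?v) $ b) = (*) (?W (Inl \<alpha>) (z \<tau>))"
        using tangent[OF xV[OF \<tau>], of \<alpha>]
        unfolding zg[OF \<tau>, symmetric] by (auto simp: sum_distrib_left mult_ac)
      finally have "((\<lambda>t. f (?x t) $ \<alpha>) has_derivative (*) (?W (Inl \<alpha>) (z \<tau>))) (at \<tau>)" .
      then have "((\<lambda>t. z t $ Inl \<alpha>) has_derivative (*) (?W (Inl \<alpha>) (z \<tau>))) (at \<tau>)"
        \<comment> \<open>z^\<alpha> and f^\<alpha> agree along the curve only for times in
          \<open>T\<close>; since \<open>T\<close> is open, the derivative carries over.\<close>
        by (rule has_derivative_transform_within_open[OF _ \<open>open T\<close> \<tau>]) (use R in simp)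
      then show ?thesis by (simp add: has_field_derivative_def)
    qed
    show "hamiltonian_solution U \<omega> H T z \<and> (\<forall>\<tau>\<in>T. \<forall>\<alpha>. \<Phi> \<alpha> (z \<tau>) = 0)"
      unfolding hamiltonian_solution_def
    proof (intro conjI ballI allI)
      fix \<tau> assume \<tau>: "\<tau> \<in> T"
      show "z \<tau> \<in> U" "\<Phi> \<alpha> (z \<tau>) = 0" for \<alpha>
        using gU[OF xV[OF \<tau>]] g0[OF xV[OF \<tau>]] unfolding zg[OF \<tau>, symmetric] by simp_all
      show "((\<lambda>t. z t $ i) has_real_derivative ?W i (z \<tau>)) (at \<tau>)" for i
        using dl[OF \<tau>] dr[OF \<tau>] by (cases i) simp_all
    qed
  qed
qed

end
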